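(* Let $n$ be an odd positive integer and $S=\{0,\dots,n-1\}$. For $q=1,2,3,4$ let $\alpha_{1q},\dots,\alpha_{4q}\in\{1,\dots,n-1\}$ be such that, for each $q$, writing $\alpha_m=\alpha_{mq}$ and $B=\alpha_1+\alpha_2+\alpha_3+\alpha_4$, for all $m\ne m'$ in $\{1,2,3,4\}$: $\gcd(\alpha_m,n)=1$; $\gcd(\alpha_m\pm\alpha_{m'},n)=1$; $\gcd(B-\alpha_m,n)=1$; $\gcd(B,n)=1$; $\gcd(B-2\alpha_m,n)=1$; $\gcd(B-\alpha_{m'}-2\alpha_m,n)=1$; $\gcd(B-2\alpha_{m'}-2\alpha_m,n)=1$; and suppose $\gcd(\det(\alpha_{pq})_{p,q=1}^4,n)=1$. Let $Q^{(q)}_{ijk\ell}\equiv\alpha_{1q}i+\alpha_{2q}j+\alpha_{3q}k+\alpha_{4q}\ell\pmod n$ with entries in $S$ (four orthogonal 4-D pandiagonal latin cubes), and define $M^{(4)}=n^3Q^{(1)}+n^2Q^{(2)}+nQ^{(3)}+Q^{(4)}$ entrywise. Then $M^{(4)}$ is a magic pandiagonal four-dimensional cube.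
   Context: For an $n\times n$ array indexed by $(x,y)\in S^2$, its ROWS are, for each $c\in S$, the index sets $\{(x,c)\}_x$, $\{(c,y)\}_y$, $\{(x,x+c\bmod n)\}_x$, $\{(x,c-x\bmod n)\}_x$. The constituent squares of an $n\times n\times n$ array are the $3n$ squares obtained by fixing one coordinate, and the six squares obtained by imposing, for one pair of coordinates $(a,b)$, either $x_a=x_b$ or $x_a+x_b=n-1$. The constituent 3-D cubes of an $n\times n\times n\times n$ array are the $4n$ cubes obtained by fixing one coordinate, and the $12$ cubes obtained by imposing, for one of the 6 pairs of coordinates $(a,b)$, either $x_a=x_b$ or $x_a+x_b=n-1$. An $n\times n\times n\times n$ array $M$ is a magic pandiagonal 4-D cube if its entries are exactly the integers $0,1,\dots,n^4-1$, each once, and the sum of the entries along every ROW of every constituent square of every constituent 3-D cube equals $n(n^4-1)/2$. *)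

theory Defs
  imports "HOL-Analysis.Determinants" "HOL-Library.Numeral_Type"
begin

text \<open>
  A \<open>d\<close>-dimensional array of order \<open>n\<close> is a function on lists of length \<open>d\<close> with entries in
  \<open>S = {0..<n}\<close>; only its values on these lists matter.
\<close>

definition indices :: "int \<Rightarrow> nat \<Rightarrow> int list set" where
  "indices n d = {xs. length xs = d \<and> set xs \<subseteq> {0..<n}}"

definition rows :: "int \<Rightarrow> int list set set" where
  "rows n = (\<Union>c\<in>{0..<n}.
     {{[x, c] | x. x \<in> {0..<n}},
      {[c, y] | y. y \<in> {0..<n}},
      {[x, (x + c) mod n] | x. x \<in> {0..<n}},
      {[x, (c - x) mod n] | x. x \<in> {0..<n}}})"

definition insert_at :: "nat \<Rightarrow> 'a \<Rightarrow> 'a list \<Rightarrow> 'a list" where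
  "insert_at i v xs = take i xs @ v # drop i xs"

text \<open>
  The \<open>(d - 1)\<close>-dimensional constituents of a \<open>d\<close>-dimensional array, each indexed by the remaining
  coordinates in their original order. If \<open>x\<^sub>a = x\<^sub>b\<close> or \<open>x\<^sub>a + x\<^sub>b = n - 1\<close> is imposed with \<open>a < b\<close>,
  the coordinate \<open>x\<^sub>b\<close> is the one eliminated; \<open>x\<^sub>a\<close> keeps its position \<open>a\<close>. Eliminating \<open>x\<^sub>a\<close> instead
  would permute coordinates or replace some \<open>x\<close> by \<open>n - 1 - x\<close>, neither of which changes the
  resulting collection of rows as sets of cells of the original array.
\<close>

definition constituents :: "int \<Rightarrow> nat \<Rightarrow> (int list \<Rightarrow> int) \<Rightarrow> (int list \<Rightarrow> int) set" where
  "constituents n d A =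
     {\<lambda>xs. A (insert_at a c xs) | a c. a < d \<and> c \<in> {0..<n}} \<union>
     {\<lambda>xs. A (insert_at b (xs ! a) xs) | a b. a < b \<and> b < d} \<union>
     {\<lambda>xs. A (insert_at b (n - 1 - xs ! a) xs) | a b. a < b \<and> b < d}"

text \<open>The division by 2 is exact, as \<open>n * (n ^ 4 - 1)\<close> is always even.\<close>

definition magic_pandiagonal_4cube :: "int \<Rightarrow> (int list \<Rightarrow> int) \<Rightarrow> bool" where
  "magic_pandiagonal_4cube n M \<longleftrightarrow>
     bij_betw M (indices n 4) {0..<n ^ 4} \<and>
     (\<forall>C\<in>constituents n 4 M. \<forall>T\<in>constituents n 3 C. \<forall>R\<in>rows n.
        (\<Sum>p\<in>R. T p) = n * (n ^ 4 - 1) div 2)"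

text \<open>
  The type \<open>4\<close> has exactly the elements 1, 2, 3, 4 (with \<open>4 = 0\<close>). List positions count from 0,
  so \<open>xs = [i, j, k, l]\<close>.
\<close>

definition latin_4cube :: "int \<Rightarrow> int ^ 4 ^ 4 \<Rightarrow> 4 \<Rightarrow> int list \<Rightarrow> int" where
  "latin_4cube n \<alpha> q xs =
     (\<alpha> $ 1 $ q * xs ! 0 + \<alpha> $ 2 $ q * xs ! 1 + \<alpha> $ 3 $ q * xs ! 2 + \<alpha> $ 4 $ q * xs ! 3) mod n"

definition composite_4cube :: "int \<Rightarrow> int ^ 4 ^ 4 \<Rightarrow> int list \<Rightarrow> int" where
  "composite_4cube n \<alpha> xs =
     n ^ 3 * latin_4cube n \<alpha> 1 xs + n ^ 2 * latin_4cube n \<alpha> 2 xs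
       + n * latin_4cube n \<alpha> 3 xs + latin_4cube n \<alpha> 4 xs"

end

theory Submission
  imports Defs "HOL-Number_Theory.Cong"
begin

text \<open>
  Along any row of any constituent square, each of the four coordinates is congruent modulo \<open>n\<close> to
  \<open>v\<^sub>i x + w\<^sub>i\<close>, where \<open>x\<close> runs through \<open>S\<close> and the direction \<open>v \<in> {-1, 0, 1}\<^sup>4\<close> is nonzero. Up to an
  overall sign, the gcd conditions say exactly that the slope \<open>\<Sum>\<^sub>i v\<^sub>i \<alpha>\<^sub>i\<^sub>q\<close> is coprime to \<open>n\<close> for
  every such \<open>v\<close>, so each latin cube takes every value of \<open>S\<close> once on the row, and the row sum of
  the composite is \<open>(n\<^sup>3 + n\<^sup>2 + n + 1) n (n - 1) / 2\<close>. The entries are distinct because the values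
  of the latin cubes are base-\<open>n\<close> digits, and these determine the cell since the determinant of the
  coefficients is invertible modulo \<open>n\<close>.
\<close>

section \<open>Residue sums and base-\<open>n\<close> digits\<close>

lemma sum_residues_affine:
  fixes n a b :: int
  assumes "coprime a n" "n > 0"
  shows "(\<Sum>x\<in>{0..<n}. (a * x + b) mod n) = \<Sum>{0..<n}"
proof -
  let ?f = "\<lambda>x. (a * x + b) mod n"
  have "inj_on ?f {0..<n}"
  proof (rule inj_onI)
    fix x y assume xy: "x \<in> {0..<n}" "y \<in> {0..<n}" "?f x = ?f y"
    then have "[a * x + b = a * y + b] (mod n)" by (simp add: cong_def)
    then have "[a * x = a * y] (mod n)" by (simp add: cong_add_rcancel)
    then have "[x = y] (mod n)" using assms by (simp add: cong_mult_lcancel)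
    then show "x = y" using xy by (auto intro: cong_less_imp_eq_int)
  qed
  moreover have "?f ` {0..<n} \<subseteq> {0..<n}" using assms by auto
  ultimately have "bij_betw ?f {0..<n} {0..<n}"
    by (simp add: bij_betw_def endo_inj_surj)
  from sum.reindex_bij_betw[OF this, of "\<lambda>x. x"] show ?thesis by simp
qed

lemma double_sum_atLeast0LessThan_int:
  fixes n :: int
  assumes "n \<ge> 0"
  shows "2 * \<Sum>{0..<n} = n * (n - 1)"
  using assms
proof (induction rule: int_ge_induct)
  case (step i)
  then have "{0..<i + 1} = insert i {0..<i}" by auto
  with step show ?case by (simp add: algebra_simps)
qed simp

lemma div_mod_unique_int:
  fixes n a b r s :: int
  assumes "n * a + r = n * b + s" "r \<in> {0..<n}" "s \<in> {0..<n}"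
  shows "a = b" "r = s"
proof -
  have "(n * a + r) div n = a" "(n * b + s) div n = b"
       "(n * a + r) mod n = r" "(n * b + s) mod n = s"
    using assms(2,3) by (auto simp: div_add1_eq)
  then show "a = b" "r = s" using assms(1) by auto
qed

section \<open>Cramer's rule and divisibility modulo \<open>n\<close>\<close>

text \<open>Cramer's rule for rows: expand by multilinearity in row \<open>k\<close>. Every term
  with \<open>j \<noteq> k\<close> has rows \<open>j\<close> and \<open>k\<close> equal and
  vanishes.\<close>

lemma det_replace_row_by_combination:
  fixes A :: "'a::comm_ring_1 ^ 'n ^ 'n"
  shows "det (\<chi> i. if i = k then \<Sum>j\<in>UNIV. x j *s A $ j else A $ i) = x k * det A"
proof -
  have "det (\<chi> i. if i = k then \<Sum>j\<in>UNIV. x j *s A $ j else A $ i)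
      = (\<Sum>j\<in>UNIV. x j * det (\<chi> i. if i = k then A $ j else A $ i))"
    by (simp add: det_linear_row_sum[where a = "\<lambda>i j. x j *s A $ j"]
        det_row_mul[where a = "\<lambda>i. A $ j" for j])
  also have "\<dots> = (\<Sum>j\<in>UNIV. if j = k then x k * det A else 0)"
  proof (rule sum.cong)
    fix j
    show "x j * det (\<chi> i. if i = k then A $ j else A $ i) = (if j = k then x k * det A else 0)"
    proof (cases "j = k")
      case True
      then have "(\<chi> i. if i = k then A $ j else A $ i) = A" by (simp add: vec_eq_iff)
      with True show ?thesis by simp
    next
      case False
      then have "det (\<chi> i. if i = k then A $ j else A $ i) = 0"
        by (intro det_identical_rows[of j k]) (auto simp: row_def)
      with False show ?thesis by simp
    qed
  qed simp
  finally show ?thesis by simp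
qed

text \<open>Injectivity modulo \<open>n\<close> without inverting a matrix over the residue ring.
  Putting the combination in place of row \<open>k\<close> multiplies the determinant by
  \<open>z k\<close>, while the factor \<open>n\<close> of the new row comes out; \<open>n\<close>
  is then cancelled against the coprime \<open>det A\<close>.\<close>

lemma combination_dvd_imp_coeff_dvd:
  fixes A :: "int ^ 'n ^ 'n" and z :: "'n \<Rightarrow> int"
  assumes "coprime (det A) n" and "\<And>q. n dvd (\<Sum>p\<in>UNIV. z p * A $ p $ q)"
  shows "n dvd z k"
proof -
  obtain w where w: "\<And>q. (\<Sum>p\<in>UNIV. z p * A $ p $ q) = n * w q"
    using assms(2) unfolding dvd_def by metis
  have "(\<Sum>p\<in>UNIV. z p *s A $ p) = n *s (\<chi> q. w q)"
    by (simp add: vec_eq_iff w)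
  then have "z k * det A = det (\<chi> i. if i = k then n *s (\<chi> q. w q) else A $ i)"
    using det_replace_row_by_combination[of k z A] by metis
  also have "\<dots> = n * det (\<chi> i. if i = k then (\<chi> q. w q) else A $ i)"
    by (rule det_row_mul)
  finally have "n dvd z k * det A" by simp
  then show ?thesis using assms(1) by (simp add: coprime_dvd_mult_left_iff coprime_commute)
qed

section \<open>Rows as affine lines modulo \<open>n\<close>\<close>

text \<open>Congruence instead of equality absorbs the wrap-around of broken diagonals. The
  dimension is a parameter because a row is lifted from a square through a cube to the 4-D
  array.\<close>

definition signed_line :: "int \<Rightarrow> nat \<Rightarrow> (int \<Rightarrow> int list) \<Rightarrow> bool" where
  "signed_line n d P \<longleftrightarrow> (\<exists>v w. (\<forall>i<d. v i \<in> {-1, 0, 1}) \<and> (\<exists>i<d. v i \<noteq> 0) \<and>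
     (\<forall>x\<in>{0..<n}. length (P x) = d \<and> (\<forall>i<d. [P x ! i = v i * x + w i] (mod n))))"

lemma nth_insert_at:
  assumes "b \<le> length xs" "i \<le> length xs"
  shows "insert_at b c xs ! i = (if i < b then xs ! i else if i = b then c else xs ! (i - 1))"
  using assms by (auto simp: insert_at_def nth_append nth_Cons' min_def)

lemma length_insert_at [simp]: "length (insert_at b c xs) = Suc (length xs)"
  by (simp add: insert_at_def)

lemma signed_line_insert_at:
  assumes "signed_line n d P" "b \<le> d" "s \<in> {-1, 0, 1}"
    and c: "\<And>x. x \<in> {0..<n} \<Longrightarrow> [c x = s * x + t] (mod n)"
  shows "signed_line n (Suc d) (\<lambda>x. insert_at b (c x) (P x))"
proof -
  obtain v w k where v: "\<forall>i<d. v i \<in> {-1, 0, 1}" and k: "k < d" "v k \<noteq> 0"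
    and P: "\<forall>x\<in>{0..<n}. length (P x) = d \<and> (\<forall>i<d. [P x ! i = v i * x + w i] (mod n))"
    using assms(1) unfolding signed_line_def by blast
  define v' where "v' i = (if i < b then v i else if i = b then s else v (i - 1))" for i
  define w' where "w' i = (if i < b then w i else if i = b then t else w (i - 1))" for i
  have "\<forall>i<Suc d. v' i \<in> {-1, 0, 1}"
    using v assms(2,3) by (auto simp: v'_def)
  \<comment> \<open>The new slope \<open>s\<close> may be 0, so the witness is the old nonzero
    coordinate \<open>k\<close>, shifted by one if it lies at or after the insertion point.\<close>
  moreover have "\<exists>i<Suc d. v' i \<noteq> 0"
    using k by (intro exI[of _ "if k < b then k else Suc k"]) (auto simp: v'_def)
  moreover have "\<forall>x\<in>{0..<n}. length (insert_at b (c x) (P x)) = Suc d \<and>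
      (\<forall>i<Suc d. [insert_at b (c x) (P x) ! i = v' i * x + w' i] (mod n))"
    using P c assms(2) by (auto simp: nth_insert_at v'_def w'_def)
  ultimately show ?thesis unfolding signed_line_def by blast
qed

text \<open>Lifts a line by one dimension. The restored coordinate has slope 0 if it was fixed,
  \<open>v a\<close> if it equals \<open>x_a\<close>, and \<open>- v a\<close> if it is the
  reflection of \<open>x_a\<close>. As \<open>a < b\<close>, position \<open>a\<close> means the
  same before and after the insertion.\<close>

lemma constituent_signed_line:
  assumes "C \<in> constituents n (Suc d) A" "signed_line n d P"
  obtains P' where "signed_line n (Suc d) P'" "\<And>x. C (P x) = A (P' x)"
proof -
  obtain v w where v: "\<forall>i<d. v i \<in> {-1, 0, 1}"
    and P: "\<forall>x\<in>{0..<n}. length (P x) = d \<and> (\<forall>i<d. [P x ! i = v i * x + w i] (mod n))"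
    using assms(2) unfolding signed_line_def by blast
  from assms(1) consider
      (fixed) a c where "C = (\<lambda>xs. A (insert_at a c xs))" "a < Suc d"
    | (equal) a b where "C = (\<lambda>xs. A (insert_at b (xs ! a) xs))" "a < b" "b < Suc d"
    | (reflected) a b where "C = (\<lambda>xs. A (insert_at b (n - 1 - xs ! a) xs))" "a < b" "b < Suc d"
    unfolding constituents_def by blast
  then show thesis
  proof cases
    case fixed
    have "signed_line n (Suc d) (\<lambda>x. insert_at a c (P x))"
      using fixed by (intro signed_line_insert_at[where s = 0 and t = c] assms(2)) auto
    with fixed that show ?thesis by simp
  next
    case equal
    have "signed_line n (Suc d) (\<lambda>x. insert_at b (P x ! a) (P x))"
      using equal v P by (intro signed_line_insert_at[where s = "v a" and t = "w a"] assms(2)) auto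
    with equal that show ?thesis by simp
  next
    case reflected
    have "[n - 1 - P x ! a = - v a * x + (n - 1 - w a)] (mod n)" if "x \<in> {0..<n}" for x
    proof -
      have "[n - 1 - P x ! a = n - 1 - (v a * x + w a)] (mod n)"
        using that P reflected by (intro cong_diff) auto
      then show ?thesis by (simp add: algebra_simps)
    qed
    moreover have "- v a \<in> {-1, 0, 1}"
      using v[rule_format, of a] reflected by auto
    ultimately have "signed_line n (Suc d) (\<lambda>x. insert_at b (n - 1 - P x ! a) (P x))"
      using reflected by (intro signed_line_insert_at[where s = "- v a"] assms(2)) auto
    with reflected that show ?thesis by simp
  qed
qed

text \<open>Rows are sets of cells, so injectivity of \<open>P\<close> is what turns a sum over
  \<open>R\<close> into a sum over the parameter.\<close>

lemma row_signed_line: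
  assumes "R \<in> rows n"
  obtains P where "R = P ` {0..<n}" "inj_on P {0..<n}" "signed_line n 2 P"
proof -
  have line: "signed_line n 2 (\<lambda>x. [f x, g x])"
    if "s \<in> {-1, 0, 1}" "t \<in> {-1, 0, 1}" "s \<noteq> 0 \<or> t \<noteq> 0"
      "\<And>x. [f x = s * x + u] (mod n)" "\<And>x. [g x = t * x + u'] (mod n)" for f g s t u u'
    unfolding signed_line_def
    using that
    by (intro exI[of _ "\<lambda>i. if i = 0 then s else t"] exI[of _ "\<lambda>i. if i = 0 then u else u'"])
      (auto simp: numeral_2_eq_2 less_Suc_eq)
  obtain c where "R \<in> {{[x, c] | x. x \<in> {0..<n}}, {[c, y] | y. y \<in> {0..<n}},
      {[x, (x + c) mod n] | x. x \<in> {0..<n}}, {[x, (c - x) mod n] | x. x \<in> {0..<n}}}"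
    using assms unfolding rows_def by blast
  then consider "R = (\<lambda>x. [x, c]) ` {0..<n}" | "R = (\<lambda>x. [c, x]) ` {0..<n}"
    | "R = (\<lambda>x. [x, (x + c) mod n]) ` {0..<n}" | "R = (\<lambda>x. [x, (c - x) mod n]) ` {0..<n}"
    by (auto simp: setcompr_eq_image atLeastLessThan_def atLeast_def lessThan_def Int_def)
  then show thesis
  proof cases
    case 1
    then show ?thesis
      by (rule that) (auto intro: inj_onI line[where s = 1 and t = 0 and u = 0 and u' = c])
  next
    case 2
    then show ?thesis
      by (rule that) (auto intro: inj_onI line[where s = 0 and t = 1 and u = c and u' = 0])
  next
    case 3
    then show ?thesis
      by (rule that)
        (auto intro: inj_onI simp: cong_def intro!: line[where s = 1 and t = 1 and u = 0 and u' = c])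
  next
    case 4
    then show ?thesis
      by (rule that)
        (auto intro: inj_onI simp: cong_def intro!: line[where s = 1 and t = "-1" and u = 0 and u' = c])
  qed
qed

section \<open>Coprimality of all slopes\<close>

text \<open>The 80 nonzero sign vectors form 40 pairs up to sign. By size of support the hypotheses
  supply one representative of each pair: 4 with one nonzero entry, 6 + 6 with two, 4 + 6 + 6 with
  three, and 1 + 4 + 3 with four.\<close>

lemma coprime_signed_sum:
  fixes n :: int and a :: "4 \<Rightarrow> int"
  defines "b \<equiv> a 1 + a 2 + a 3 + a 4"
  assumes one: "\<And>m. coprime (a m) n"
    and two: "\<And>m m'. m \<noteq> m' \<Longrightarrow> coprime (a m + a m') n"
      "\<And>m m'. m \<noteq> m' \<Longrightarrow> coprime (a m - a m') n"
    and three: "\<And>m. coprime (b - a m) n"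
      "\<And>m m'. m \<noteq> m' \<Longrightarrow> coprime (b - a m' - 2 * a m) n"
    and four: "coprime b n" "\<And>m. coprime (b - 2 * a m) n"
      "\<And>m m'. m \<noteq> m' \<Longrightarrow> coprime (b - 2 * a m' - 2 * a m) n"
    and v: "v\<^sub>1 \<in> {-1, 0, 1}" "v\<^sub>2 \<in> {-1, 0, 1}" "v\<^sub>3 \<in> {-1, 0, 1}" "v\<^sub>4 \<in> {-1, 0, 1}"
      "\<not> (v\<^sub>1 = 0 \<and> v\<^sub>2 = 0 \<and> v\<^sub>3 = 0 \<and> v\<^sub>4 = 0)"
  shows "coprime (a 1 * v\<^sub>1 + a 2 * v\<^sub>2 + a 3 * v\<^sub>3 + a 4 * v\<^sub>4) n"
proof -
  define L where "L p q r s = a 1 * p + a 2 * q + a 3 * r + a 4 * s" for p q r s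
  have ne: "(1::4) \<noteq> 2" "(1::4) \<noteq> 3" "(1::4) \<noteq> 4" "(2::4) \<noteq> 3" "(2::4) \<noteq> 4" "(3::4) \<noteq> 4"
    by simp_all
  \<comment> \<open>With the equation as a separate goal, \<open>rule\<close> can try each instance
    of a hypothesis and \<open>simp\<close> keeps the one with the matching linear form.\<close>
  have eq: "coprime x n" if "coprime y n" "x = y" for x y
    using that by simp
  have L1:
    "coprime (L 1 0 0 0) n" "coprime (L 0 1 0 0) n" "coprime (L 0 0 1 0) n"
    "coprime (L 0 0 0 1) n"
    by (rule one[of 1, THEN eq] one[of 2, THEN eq]
        one[of 3, THEN eq] one[of 4, THEN eq],
      simp add: L_def b_def)+
  have L2:
    "coprime (L 1 1 0 0) n" "coprime (L 1 0 1 0) n" "coprime (L 1 0 0 1) n"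
    "coprime (L 0 1 1 0) n" "coprime (L 0 1 0 1) n" "coprime (L 0 0 1 1) n"
    by (rule ne[THEN two(1), THEN eq], simp add: L_def b_def)+
  have L2':
    "coprime (L 1 (-1) 0 0) n" "coprime (L 1 0 (-1) 0) n" "coprime (L 1 0 0 (-1)) n"
    "coprime (L 0 1 (-1) 0) n" "coprime (L 0 1 0 (-1)) n" "coprime (L 0 0 1 (-1)) n"
    by (rule ne[THEN two(2), THEN eq], simp add: L_def b_def)+
  have L3:
    "coprime (L 0 1 1 1) n" "coprime (L 1 0 1 1) n" "coprime (L 1 1 0 1) n"
    "coprime (L 1 1 1 0) n"
    by (rule three(1)[of 1, THEN eq] three(1)[of 2, THEN eq]
        three(1)[of 3, THEN eq] three(1)[of 4, THEN eq],
      simp add: L_def b_def)+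
  have L3':
    "coprime (L (-1) 0 1 1) n" "coprime (L (-1) 1 0 1) n" "coprime (L (-1) 1 1 0) n"
    "coprime (L 1 (-1) 0 1) n" "coprime (L 1 (-1) 1 0) n" "coprime (L 1 1 (-1) 0) n"
    by (rule ne[THEN three(2), THEN eq], simp add: L_def b_def)+
  have L3'':
    "coprime (L 0 (-1) 1 1) n" "coprime (L 0 1 (-1) 1) n" "coprime (L 0 1 1 (-1)) n"
    "coprime (L 1 0 (-1) 1) n" "coprime (L 1 0 1 (-1)) n" "coprime (L 1 1 0 (-1)) n"
    by (rule ne[symmetric, THEN three(2), THEN eq], simp add: L_def b_def)+
  have L4:
    "coprime (L 1 1 1 1) n"
    by (rule four(1)[THEN eq], simp add: L_def b_def)+
  have L4':
    "coprime (L (-1) 1 1 1) n" "coprime (L 1 (-1) 1 1) n" "coprime (L 1 1 (-1) 1) n"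
    "coprime (L 1 1 1 (-1)) n"
    by (rule four(2)[of 1, THEN eq] four(2)[of 2, THEN eq]
        four(2)[of 3, THEN eq] four(2)[of 4, THEN eq],
      simp add: L_def b_def)+
  \<comment> \<open>Three of the six pairs suffice: flipping the complementary pair of signs gives
    the negated form.\<close>
  have L4'': "coprime (L (-1) (-1) 1 1) n" "coprime (L (-1) 1 (-1) 1) n" "coprime (L (-1) 1 1 (-1)) n"
    by (rule ne[THEN four(3), THEN eq], simp add: L_def b_def)+
  note pos = L1 L2 L2' L3 L3' L3'' L4 L4' L4''
  have "coprime (L (- p) (- q) (- r) (- s)) n" if "coprime (L p q r s) n" for p q r s
  proof -
    have "L (- p) (- q) (- r) (- s) = - L p q r s" by (simp add: L_def)
    with that show ?thesis by simp
  qed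
  note neg = pos[THEN this, unfolded minus_minus minus_zero]
  \<comment> \<open>Of the 81 cases, 80 are in \<open>pos\<close> or \<open>neg\<close>; the zero
    vector contradicts the last assumption in \<open>v\<close>.\<close>
  from v have "coprime (L v\<^sub>1 v\<^sub>2 v\<^sub>3 v\<^sub>4) n"
    unfolding insert_iff empty_iff by (elim disjE FalseE; simp only: pos neg) simp
  then show ?thesis by (simp add: L_def)
qed

section \<open>The latin cubes as digits of the composite\<close>

lemma latin_4cube_signed_line:
  fixes \<alpha> :: "int ^ 4 ^ 4"
  assumes "\<forall>i<4. [P x ! i = v i * x + w i] (mod n)"
  shows "latin_4cube n \<alpha> q (P x) =
    ((\<alpha> $ 1 $ q * v 0 + \<alpha> $ 2 $ q * v 1 + \<alpha> $ 3 $ q * v 2 + \<alpha> $ 4 $ q * v 3) * x +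
     (\<alpha> $ 1 $ q * w 0 + \<alpha> $ 2 $ q * w 1 + \<alpha> $ 3 $ q * w 2 + \<alpha> $ 4 $ q * w 3)) mod n"
proof -
  have "[\<alpha> $ 1 $ q * P x ! 0 + \<alpha> $ 2 $ q * P x ! 1 + \<alpha> $ 3 $ q * P x ! 2 + \<alpha> $ 4 $ q * P x ! 3
      = \<alpha> $ 1 $ q * (v 0 * x + w 0) + \<alpha> $ 2 $ q * (v 1 * x + w 1)
        + \<alpha> $ 3 $ q * (v 2 * x + w 2) + \<alpha> $ 4 $ q * (v 3 * x + w 3)] (mod n)"
    using assms by (intro cong_add cong_mult cong_refl) auto
  then show ?thesis
    unfolding latin_4cube_def cong_def by (simp add: algebra_simps)
qed

text \<open>Horner form, so that digits can be split off one at a time by division by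
  \<open>n\<close>.\<close>

lemma composite_4cube_horner:
  "composite_4cube n \<alpha> xs =
    n * (n * (n * latin_4cube n \<alpha> 1 xs + latin_4cube n \<alpha> 2 xs) + latin_4cube n \<alpha> 3 xs)
      + latin_4cube n \<alpha> 4 xs"
  by (simp add: composite_4cube_def algebra_simps power3_eq_cube power2_eq_square)

lemma inj_on_composite_4cube:
  assumes "n > 0" "coprime (det \<alpha>) n"
  shows "inj_on (composite_4cube n \<alpha>) (indices n 4)"
proof (rule inj_onI)
  fix xs ys
  assume xs: "xs \<in> indices n 4" and ys: "ys \<in> indices n 4"
    and eq: "composite_4cube n \<alpha> xs = composite_4cube n \<alpha> ys"
  have dig: "latin_4cube n \<alpha> q zs \<in> {0..<n}" for q zs
    using assms(1) by (simp add: latin_4cube_def)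
  \<comment> \<open>Digits are compared from the least significant one upwards; \<open>e2\<close>
    yields the two leading digits together.\<close>
  note e4 = div_mod_unique_int[OF eq[unfolded composite_4cube_horner] dig dig]
  note e3 = div_mod_unique_int[OF e4(1) dig dig]
  note e2 = div_mod_unique_int[OF e3(1) dig dig]
  have latin: "latin_4cube n \<alpha> q xs = latin_4cube n \<alpha> q ys" for q
    using exhaust_4[of q] e4(2) e3(2) e2 by auto
  \<comment> \<open>Translates the matrix index, running over 1 to 4 in the cyclic type
    \<open>4\<close>, into a list position counted from 0.\<close>
  define pos :: "4 \<Rightarrow> nat"
    where "pos p = (if p = 1 then 0 else if p = 2 then 1 else if p = 3 then 2 else 3)" for p
  \<comment> \<open>Equal latin values say that the coordinate differences, as coefficients of the
    rows of \<open>\<alpha>\<close>, combine to 0 modulo \<open>n\<close> in every column.\<close>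
  have "n dvd (\<Sum>p\<in>UNIV. (xs ! pos p - ys ! pos p) * \<alpha> $ p $ q)" for q
    using latin[of q] unfolding latin_4cube_def mod_eq_dvd_iff
    by (simp add: sum_4 pos_def algebra_simps)
  then have dvd: "n dvd xs ! pos p - ys ! pos p" for p
    using combination_dvd_imp_coeff_dvd[OF assms(2), of "\<lambda>p. xs ! pos p - ys ! pos p"] by blast
  have "xs ! i = ys ! i" if "i < 4" for i
  proof -
    obtain p where "i = pos p"
    proof -
      have "i = pos 1 \<or> i = pos 2 \<or> i = pos 3 \<or> i = pos 4"
        using \<open>i < 4\<close> by (auto simp: pos_def)
      then show thesis using that by blast
    qed
    then have "[xs ! i = ys ! i] (mod n)" using dvd by (simp add: cong_iff_dvd_diff)
    moreover have "xs ! i \<in> {0..<n}" "ys ! i \<in> {0..<n}"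
      using xs ys \<open>i < 4\<close> unfolding indices_def by (metis (mono_tags, lifting) mem_Collect_eq nth_mem subsetD)+
    ultimately show ?thesis by (auto intro: cong_less_imp_eq_int)
  qed
  then show "xs = ys" using xs ys by (intro nth_equalityI) (auto simp: indices_def)
qed

text \<open>An injection into a set of the same finite size: both sides have \<open>n ^ 4\<close>
  elements.\<close>

lemma bij_betw_composite_4cube:
  assumes "n > 0" "coprime (det \<alpha>) n"
  shows "bij_betw (composite_4cube n \<alpha>) (indices n 4) {0..<n ^ 4}"
proof -
  \<comment> \<open>One Horner step; three of them bound the composite. Integrality gives
    \<open>a + 1 \<le> m\<close>.\<close>
  have horner: "n * a + r \<in> {0..<n * m}" if "a \<in> {0..<m}" "r \<in> {0..<n}" for a r m
  proof -
    have "n * a + r < n * (a + 1)" using that by (simp add: algebra_simps)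
    also have "\<dots> \<le> n * m" using that assms(1) by (intro mult_left_mono) auto
    finally show ?thesis using that assms(1) by simp
  qed
  have dig: "latin_4cube n \<alpha> q zs \<in> {0..<n}" for q zs
    using assms(1) by (simp add: latin_4cube_def)
  have "composite_4cube n \<alpha> xs \<in> {0..<n * (n * (n * n))}" for xs
    unfolding composite_4cube_horner by (intro horner dig)
  then have "composite_4cube n \<alpha> ` indices n 4 \<subseteq> {0..<n ^ 4}"
    by (auto simp: power4_eq_xxxx mult.assoc)
  moreover have "card (composite_4cube n \<alpha> ` indices n 4) = card {0..<n ^ 4}"
  proof -
    have "indices n 4 = {xs. set xs \<subseteq> {0..<n} \<and> length xs = 4}"
      by (auto simp: indices_def)
    then have "card (indices n 4) = nat n ^ 4"
      by (simp add: card_lists_length_eq)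
    then show ?thesis
      using assms(1) by (simp add: card_image[OF inj_on_composite_4cube[OF assms]] nat_power_eq)
  qed
  ultimately show ?thesis
    using inj_on_composite_4cube[OF assms] by (simp add: bij_betw_def card_subset_eq)
qed

section \<open>Row sums of the composite\<close>

theorem mainTheorem10:
  fixes n :: int and \<alpha> :: "int ^ 4 ^ 4" and B :: "4 \<Rightarrow> int"
  assumes "odd n" and "n > 0"
    and "\<And>p q. \<alpha> $ p $ q \<in> {1..n - 1}"
    and "\<And>q. B q = \<alpha> $ 1 $ q + \<alpha> $ 2 $ q + \<alpha> $ 3 $ q + \<alpha> $ 4 $ q"
    and "\<And>q m. gcd (\<alpha> $ m $ q) n = 1"
    and "\<And>q m m'. m \<noteq> m' \<Longrightarrow> gcd (\<alpha> $ m $ q + \<alpha> $ m' $ q) n = 1"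
    and "\<And>q m m'. m \<noteq> m' \<Longrightarrow> gcd (\<alpha> $ m $ q - \<alpha> $ m' $ q) n = 1"
    and "\<And>q m. gcd (B q - \<alpha> $ m $ q) n = 1"
    and "\<And>q. gcd (B q) n = 1"
    and "\<And>q m. gcd (B q - 2 * \<alpha> $ m $ q) n = 1"
    and "\<And>q m m'. m \<noteq> m' \<Longrightarrow> gcd (B q - \<alpha> $ m' $ q - 2 * \<alpha> $ m $ q) n = 1"
    and "\<And>q m m'. m \<noteq> m' \<Longrightarrow> gcd (B q - 2 * \<alpha> $ m' $ q - 2 * \<alpha> $ m $ q) n = 1"
    and "gcd (det \<alpha>) n = 1"
  shows "magic_pandiagonal_4cube n (composite_4cube n \<alpha>)"
proof -
  have line_sum: "(\<Sum>x\<in>{0..<n}. composite_4cube n \<alpha> (P x)) = n * (n ^ 4 - 1) div 2"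
    if line: "signed_line n 4 P" for P
  proof -
    obtain v w where v: "\<forall>i<4. v i \<in> {-1, 0, 1}" "\<exists>i<4. v i \<noteq> 0"
      and P: "\<forall>x\<in>{0..<n}. length (P x) = 4 \<and> (\<forall>i<4. [P x ! i = v i * x + w i] (mod n))"
      using line unfolding signed_line_def by blast
    have dir: "v 0 \<in> {-1, 0, 1}" "v 1 \<in> {-1, 0, 1}" "v 2 \<in> {-1, 0, 1}" "v 3 \<in> {-1, 0, 1}"
      using v(1) by simp_all
    have nz: "\<not> (v 0 = 0 \<and> v 1 = 0 \<and> v 2 = 0 \<and> v 3 = 0)"
    proof
      assume z: "v 0 = 0 \<and> v 1 = 0 \<and> v 2 = 0 \<and> v 3 = 0"
      obtain i where "i < 4" "v i \<noteq> 0" using v(2) by blast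
      moreover from \<open>i < 4\<close> have "i = 0 \<or> i = 1 \<or> i = 2 \<or> i = 3" by linarith
      ultimately show False using z by blast
    qed
    have latin_sum: "(\<Sum>x\<in>{0..<n}. latin_4cube n \<alpha> q (P x)) = \<Sum>{0..<n}" for q
    proof -
      let ?s = "\<alpha> $ 1 $ q * v 0 + \<alpha> $ 2 $ q * v 1 + \<alpha> $ 3 $ q * v 2 + \<alpha> $ 4 $ q * v 3"
      let ?t = "\<alpha> $ 1 $ q * w 0 + \<alpha> $ 2 $ q * w 1 + \<alpha> $ 3 $ q * w 2 + \<alpha> $ 4 $ q * w 3"
      have "coprime ?s n"
        \<comment> \<open>Folding turns the explicit sum of the four coefficients back into
          \<open>B q\<close>, the form in which the gcd hypotheses are given.\<close>
        by (rule coprime_signed_sum[where a = "\<lambda>m. \<alpha> $ m $ q", folded assms(4)])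
          (fact assms(5-12)[folded coprime_iff_gcd_eq_1] dir nz)+
      moreover have "(\<Sum>x\<in>{0..<n}. latin_4cube n \<alpha> q (P x)) = (\<Sum>x\<in>{0..<n}. (?s * x + ?t) mod n)"
        using P by (intro sum.cong refl latin_4cube_signed_line) auto
      ultimately show ?thesis using sum_residues_affine \<open>n > 0\<close> by simp
    qed
    have "(\<Sum>x\<in>{0..<n}. composite_4cube n \<alpha> (P x)) = (n ^ 3 + n ^ 2 + n + 1) * \<Sum>{0..<n}"
      unfolding composite_4cube_def sum.distrib sum_distrib_left[symmetric] latin_sum
      by (simp add: algebra_simps)
    \<comment> \<open>Doubling avoids \<open>div\<close> until the end; the geometric factor times
      \<open>n - 1\<close> telescopes to \<open>n ^ 4 - 1\<close>.\<close>
    then have "2 * (\<Sum>x\<in>{0..<n}. composite_4cube n \<alpha> (P x)) = (n ^ 3 + n ^ 2 + n + 1) * (n * (n - 1))"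
      using double_sum_atLeast0LessThan_int[of n] \<open>n > 0\<close> by simp
    also have "\<dots> = n * (n ^ 4 - 1)"
      by algebra
    finally show ?thesis by simp
  qed
  have "(\<Sum>p\<in>R. T p) = n * (n ^ 4 - 1) div 2"
    if C: "C \<in> constituents n 4 (composite_4cube n \<alpha>)" and T: "T \<in> constituents n 3 C"
      and R: "R \<in> rows n" for C T R
  proof -
    obtain P where P: "R = P ` {0..<n}" "inj_on P {0..<n}" "signed_line n 2 P"
      using row_signed_line[OF R] .
    \<comment> \<open>The row is lifted twice, from the square \<open>T\<close> to the cube
      \<open>C\<close> and from there to the full array.\<close>
    obtain P' where P': "signed_line n 3 P'" "\<And>x. T (P x) = C (P' x)"
    proof (rule constituent_signed_line[OF _ P(3)])
      show "T \<in> constituents n (Suc 2) C" using T by simp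
    qed simp
    obtain P'' where P'': "signed_line n 4 P''" "\<And>x. C (P' x) = composite_4cube n \<alpha> (P'' x)"
    proof (rule constituent_signed_line[OF _ P'(1)])
      show "C \<in> constituents n (Suc 3) (composite_4cube n \<alpha>)" using C by simp
    qed simp
    show ?thesis
      using line_sum[OF P''(1)] by (simp only: P(1) sum.reindex[OF P(2)] o_def P'(2) P''(2))
  qed
  moreover have "coprime (det \<alpha>) n" using assms(13) by (simp add: coprime_iff_gcd_eq_1)
  ultimately show ?thesis
    unfolding magic_pandiagonal_4cube_def
    using bij_betw_composite_4cube[OF \<open>n > 0\<close>] by blast
qed

end
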